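(* Let $\{\mathcal G_k\}_{k\ge0}$, $\mathcal G_k=(\mathcal V,\mathcal E_k)$, $\mathcal V=\{1,\dots,n\}$, be a sequence of directed graphs, each with a self-loop at every node, and suppose that, for some positive integer $\bar m$, the sequence is jointly fully connected for sequences of length $\bar m$, i.e. for every index $k$ the composition $\mathcal G_k\circ\mathcal G_{k+1}\circ\dots\circ\mathcal G_{k+\bar m-1}$ is fully connected. For every index $k$ let the consensus matrix $W^k=[w_{ij}^k]\in\mathbb R^{n\times n}$ associated with $\mathcal G_k$ be row stochastic with $w_{ij}^k>0$ if $(j,i)\in\mathcal E_k$ and $w_{ij}^k=0$ if $(j,i)\notin\mathcal E_k$. Let $M=[m_{ij}]\in\mathbb R^{n\times n}$ satisfy $\|M\|_\infty=\mu<1$, let $d\in\mathbb R^n$, and let $y^*$ be the fixed point $y^*=My^*+d$, which is assumed to be a solution of the linear system $Ay=b$, where $A\in\mathbb R^{n\times n}$ is nonsingular and $b\in\mathbb R^n$. Let $\{X^k\}_{k\ge0}\subset\mathbb R^{n^2}$ be a sequence generated, from an arbitrary $X^0\in\mathbb R^{n^2}$, by $$X^{k+1}=(W^k\otimes I)(\mathcal M X^k+\hat d),$$ with $\mathcal M$ and $\hat d$ built from $M$ and $d$ as described in the context, and let $X^*=(y^*;\dots;y^* )\in\mathbb R^{n^2}$. Then there exists a constant $\sigma<1$ such that for every $k\in\mathbb N$ (with $k\ge\bar m-1$, so that the right-hand side is defined) the global error $E^k=X^k-X^*$ satisfies $$\|E^{k+1}\|_\infty\le\sigma\,\|E^{k-\bar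 m+1}\|_\infty .$$
   Context: An edge $(i,j)$ means that node $i$ can send information to node $j$. For graphs $\mathcal G_1=(\mathcal V,\mathcal E_1)$ and $\mathcal G_2=(\mathcal V,\mathcal E_2)$, the composition $\mathcal G_2\circ\mathcal G_1=(\mathcal V,\mathcal E)$ has edge set $\mathcal E=\{(j,i)\in\mathcal V^2 : \exists\, s\in\mathcal V \text{ such that } (j,s)\in\mathcal E_1,\ (s,i)\in\mathcal E_2\}$ (first edge in $\mathcal G_1$, second edge in $\mathcal G_2$); this extends to finite sequences of graphs of arbitrary length. A directed graph on $\mathcal V$ is fully connected if every ordered pair $(i,j)\in\mathcal V^2$ is an edge. Construction of the iteration (the DFIX distributed fixed point method on a time-varying network): for each $i\in\{1,\dots,n\}$, $\widehat M_i\in\mathbb R^{n\times n}$ is the matrix whose $i$-th row is the $i$-th row $(m_{i1},\dots,m_{in})$ of $M$ and whose $j$-th row, for $j\ne i$, is the $j$-th row of the identity matrix; $\widehat d_i\in\mathbb R^n$ is the vector whose $i$-th entry is $d_i$ (the $i$-th entry of $d$) and whose other entries are $0$. Then $\mathcal M=\mathrm{diag}(\widehat M_1,\dots,\widehat M_n)\in\mathbb R^{n^2\times n^2}$ (block diagonal) and $\hat d=(\widehat d_1;\dots;\widehat d_n)\in\mathbb R^{n^2}$ (stacked vectors). $I$ is the $n\times n$ identity and $\otimes$ is the Kronecker product. Writing $X^k=(x_1^k;\dots;x_n^k)$ with $x_i^k\in\mathbb R^n$ the solution estimate held by node $i$, the iteration is equivalent to $\hat x_i^{k+1}=\widehat M_i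 x_i^k+\widehat d_i$ and $x_i^{k+1}=\sum_{j=1}^n w_{ij}^k\hat x_j^{k+1}$ for all $i$. $\|\cdot\|_\infty$ is the max norm on vectors and the induced (maximum absolute row sum) norm on matrices.
   Formalization: The joint composition is taken in time order (first edge in G_k, last in G_{k+m̄-1}) instead of the literal reverse order, and the positive weights w_ij^k on edges are assumed bounded below by one w>0 uniformly in k; without either change the claim fails. *)

theory Defs
  imports "HOL-Analysis.Analysis"
begin

text \<open>
  The node set \<open>{1,\<dots>,n}\<close> is a finite index type, and a directed graph on it is its edge relation;
  \<open>(i, j)\<close> is an edge iff node \<open>i\<close> can send information to node \<open>j\<close>.
\<close>

definition graph_comp :: "'n rel \<Rightarrow> 'n rel \<Rightarrow> 'n rel" where
  "graph_comp E2 E1 = {(j, i). \<exists>s. (j, s) \<in> E1 \<and> (s, i) \<in> E2}"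

definition has_self_loops :: "'n rel \<Rightarrow> bool" where
  "has_self_loops E \<longleftrightarrow> (\<forall>i. (i, i) \<in> E)"

definition fully_connected :: "'n rel \<Rightarrow> bool" where
  "fully_connected E \<longleftrightarrow> (\<forall>i j. (i, j) \<in> E)"

text \<open>
  Composition of \<open>m\<close> consecutive graphs along the flow of information: an edge of
  \<open>graph_comp_seq E k m\<close> is a walk whose first edge is in \<open>E k\<close> and whose last edge is in
  \<open>E (k + m - 1)\<close>. This is the order in which the consensus steps are applied: the support of
  \<open>W (k + m - 1) ** \<dots> ** W k\<close> is described by this composition, not by the one whose first edge
  is in \<open>E (k + m - 1)\<close>.
\<close>

primrec graph_comp_seq :: "(nat \<Rightarrow> 'n rel) \<Rightarrow> nat \<Rightarrow> nat \<Rightarrow> 'n rel" where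
  "graph_comp_seq E k 0 = Id"
| "graph_comp_seq E k (Suc m) = graph_comp (E (k + m)) (graph_comp_seq E k m)"

definition jointly_fully_connected :: "nat \<Rightarrow> (nat \<Rightarrow> 'n rel) \<Rightarrow> bool" where
  "jointly_fully_connected m E \<longleftrightarrow> (\<forall>k. fully_connected (graph_comp_seq E k m))"

definition row_stochastic :: "real^'n^'n \<Rightarrow> bool" where
  "row_stochastic W \<longleftrightarrow> (\<forall>i j. 0 \<le> W $ i $ j) \<and> (\<forall>i. (\<Sum>j\<in>UNIV. W $ i $ j) = 1)"

definition consensus_matrix :: "'n rel \<Rightarrow> real^'n^'n \<Rightarrow> bool" where
  "consensus_matrix E W \<longleftrightarrow> row_stochastic W \<and>
     (\<forall>i j. ((j, i) \<in> E \<longrightarrow> 0 < W $ i $ j) \<and> ((j, i) \<notin> E \<longrightarrow> W $ i $ j = 0))"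

text \<open>
  The positive weights do not degenerate along the sequence. This is automatic when finitely many
  different matrices occur, in particular when each matrix is determined by its graph.
\<close>

definition weights_bounded_below :: "(nat \<Rightarrow> 'n rel) \<Rightarrow> (nat \<Rightarrow> real^'n^'n) \<Rightarrow> bool" where
  "weights_bounded_below E W \<longleftrightarrow>
     (\<exists>w>0. \<forall>k i j. (j, i) \<in> E k \<longrightarrow> w \<le> W k $ i $ j)"

definition mat_infnorm :: "real^'n^'m \<Rightarrow> real" where
  "mat_infnorm A = Max (range (\<lambda>i. \<Sum>j\<in>UNIV. \<bar>A $ i $ j\<bar>))"

text \<open>
  Stacked vectors and block matrices are indexed by pairs (block, position within the block), so
  a vector of \<open>n\<^sup>2\<close> reals has type \<open>real^('n \<times> 'n)\<close>. The max norm on vectors is \<^const>\<open>infnorm\<close>.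
\<close>

definition stack :: "('n::finite \<Rightarrow> real^'m) \<Rightarrow> real^('n \<times> 'm)" where
  "stack v = (\<chi> p. v (fst p) $ snd p)"

definition block_diag :: "('n::finite \<Rightarrow> real^'m^'m) \<Rightarrow> real^('n \<times> 'm)^('n \<times> 'm)" where
  "block_diag B = (\<chi> p q. if fst p = fst q then B (fst p) $ snd p $ snd q else 0)"

definition kronecker :: "real^'b^'a \<Rightarrow> real^'d^'c \<Rightarrow> real^('b \<times> 'd)^('a \<times> 'c)" where
  "kronecker A B = (\<chi> p q. A $ fst p $ fst q * B $ snd p $ snd q)"

definition M_hat :: "real^'n^'n \<Rightarrow> 'n \<Rightarrow> real^'n^'n" where
  "M_hat M i = (\<chi> r. if r = i then M $ i else mat 1 $ r)"

definition d_hat :: "real^'n \<Rightarrow> 'n \<Rightarrow> real^'n" where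
  "d_hat d i = (\<chi> r. if r = i then d $ i else 0)"

definition dfix_step :: "real^'n^'n \<Rightarrow> real^'n^'n \<Rightarrow> real^'n \<Rightarrow> real^('n \<times> 'n) \<Rightarrow> real^('n \<times> 'n)" where
  "dfix_step W M d X =
     kronecker W (mat 1 :: real^'n^'n) *v (block_diag (M_hat M) *v X + stack (d_hat d))"

end

theory Submission
  imports Defs
begin

text \<open>
  Follow the \<open>l\<close>-th components of the errors held by the nodes. The local update at node \<open>l\<close> itself
  shrinks this component by the factor \<open>\<mu> = \<parallel>M\<parallel>\<^sub>\<infinity>\<close>, the other nodes keep theirs, and the consensus
  step averages over the nodes. Hence a node that is reached from \<open>l\<close> by a walk of length \<open>m\<close> has
  received a share of at least \<open>w\<^sup>m\<close> of the contracted value, where \<open>w\<close> bounds the positive weights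
  from below, and its error component has shrunk by the factor \<open>1 - (1 - \<mu>) w\<^sup>m\<close>. Within \<open>mbar\<close>
  steps every node is reached from every \<open>l\<close>.
\<close>

lemma infnorm_le_cart:
  fixes x :: "real^'n"
  assumes "\<And>i. \<bar>x $ i\<bar> \<le> B"
  shows "infnorm x \<le> B"
  unfolding infnorm_cart using assms by (intro cSup_least) auto

lemma row_sum_le_mat_infnorm: "(\<Sum>j\<in>UNIV. \<bar>A $ i $ j\<bar>) \<le> mat_infnorm A"
  unfolding mat_infnorm_def by (intro Max_ge) auto

lemma abs_mult_vec_le_mat_infnorm:
  assumes "\<And>j. \<bar>x $ j\<bar> \<le> e"
  shows "\<bar>(A *v x) $ i\<bar> \<le> mat_infnorm A * e"
proof -
  have e: "0 \<le> e"
    using assms abs_ge_zero order_trans by blast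
  have "\<bar>(A *v x) $ i\<bar> \<le> (\<Sum>j\<in>UNIV. \<bar>A $ i $ j\<bar> * \<bar>x $ j\<bar>)"
    unfolding matrix_vector_mult_def by (simp add: abs_mult[symmetric])
  also have "\<dots> \<le> (\<Sum>j\<in>UNIV. \<bar>A $ i $ j\<bar>) * e"
    unfolding sum_distrib_right by (intro sum_mono mult_left_mono assms) auto
  also have "\<dots> \<le> mat_infnorm A * e"
    by (intro mult_right_mono row_sum_le_mat_infnorm e)
  finally show ?thesis .
qed

lemma block_diag_mult_stack:
  fixes B :: "'n::finite \<Rightarrow> real^'m^'m"
  shows "block_diag B *v stack v = stack (\<lambda>i. B i *v v i)"
proof -
  have "(\<Sum>q\<in>UNIV. (if i = fst q then B i $ l $ snd q else 0) * v (fst q) $ snd q)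
      = (\<Sum>r\<in>UNIV. B i $ l $ r * v i $ r)" for i l
  proof -
    have "(\<Sum>q\<in>UNIV. (if i = fst q then B i $ l $ snd q else 0) * v (fst q) $ snd q)
        = (\<Sum>j\<in>UNIV. \<Sum>r\<in>UNIV. (if i = j then B i $ l $ r else 0) * v j $ r)"
      by (simp add: sum.cartesian_product case_prod_beta)
    also have "\<dots> = (\<Sum>j\<in>UNIV. if i = j then \<Sum>r\<in>UNIV. B i $ l $ r * v j $ r else 0)"
      by (intro sum.cong) auto
    finally show ?thesis by simp
  qed
  then show ?thesis
    by (simp add: vec_eq_iff stack_def block_diag_def matrix_vector_mult_def)
qed

text \<open>Consensus mixes only equal positions \<open>l\<close> of different blocks, so each
  component can be followed separately.\<close>

lemma kronecker_mat_1_mult_nth: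
  "(kronecker A (mat 1 :: real^'m^'m) *v V) $ (i, l) = (\<Sum>j\<in>UNIV. A $ i $ j * V $ (j, l))"
proof -
  have "(kronecker A (mat 1 :: real^'m^'m) *v V) $ (i, l)
      = (\<Sum>j\<in>UNIV. \<Sum>r\<in>UNIV. A $ i $ j * mat 1 $ l $ r * V $ (j, r))"
    by (simp add: matrix_vector_mult_def kronecker_def sum.cartesian_product case_prod_beta)
  also have "\<dots> = (\<Sum>j\<in>UNIV. \<Sum>r\<in>UNIV. if l = r then A $ i $ j * V $ (j, r) else 0)"
    by (intro sum.cong) (auto simp: mat_def)
  finally show ?thesis by simp
qed

lemma stack_eq: "stack (\<lambda>i. \<chi> r. V $ (i, r)) = V"
  by (simp add: vec_eq_iff stack_def)

lemma M_hat_mult_nth: "(M_hat M j *v x) $ l = (if l = j then (M *v x) $ l else x $ l)"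
proof (cases "l = j")
  case False
  then have "(M_hat M j *v x) $ l = (mat 1 *v x) $ l"
    by (simp add: M_hat_def matrix_vector_mult_def)
  with False show ?thesis by simp
qed (simp add: M_hat_def matrix_vector_mult_def)

lemma block_diag_M_hat_mult_nth:
  "(block_diag (M_hat M) *v V) $ (j, l) =
     (if j = l then (M *v (\<chi> r. V $ (l, r))) $ l else V $ (j, l))"
proof -
  have "(block_diag (M_hat M) *v V) $ (j, l)
      = stack (\<lambda>i. M_hat M i *v (\<chi> r. V $ (i, r))) $ (j, l)"
    using block_diag_mult_stack[of "M_hat M" "\<lambda>i. \<chi> r. V $ (i, r)"] by (simp only: stack_eq)
  then show ?thesis
    by (simp add: stack_def M_hat_mult_nth)
qed

text \<open>In block \<open>i\<close>, row \<open>i\<close> is row \<open>i\<close> of the fixed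
  point equation; the other rows are identity rows with zero offset.\<close>

lemma dfix_fixed_point:
  assumes "y = M *v y + d"
  shows "block_diag (M_hat M) *v stack (\<lambda>_. y) + stack (d_hat d) = stack (\<lambda>_. y)"
proof -
  have "(M_hat M i *v y + d_hat d i) $ l = y $ l" for i l
    using arg_cong[OF assms, of "\<lambda>v. v $ i"] by (simp add: M_hat_mult_nth d_hat_def)
  then show ?thesis
    by (simp add: block_diag_mult_stack) (simp add: stack_def vec_eq_iff)
qed

text \<open>Row sums equal to 1 make consensus preserve vectors with identical blocks. The stacked
  fixed point thus survives both half-steps, and subtracting it cancels the offset.\<close>

lemma dfix_step_error:
  assumes W: "row_stochastic W" and y: "y = M *v y + d"
  shows "dfix_step W M d X - stack (\<lambda>_. y) =
     kronecker W (mat 1 :: real^'n^'n) *v (block_diag (M_hat M) *v (X - stack (\<lambda>_. y)))"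
proof -
  let ?Y = "stack (\<lambda>_. y)" and ?K = "kronecker W (mat 1 :: real^'n^'n)"
  have "?K *v ?Y = ?Y"
    using W by (auto simp: vec_eq_iff kronecker_mat_1_mult_nth stack_def row_stochastic_def
        simp flip: sum_distrib_right)
  then have "dfix_step W M d X - ?Y = dfix_step W M d X - ?K *v ?Y"
    by simp
  also have "\<dots> = ?K *v (block_diag (M_hat M) *v X + stack (d_hat d)
                 - (block_diag (M_hat M) *v ?Y + stack (d_hat d)))"
    by (simp add: dfix_step_def dfix_fixed_point[OF y] matrix_vector_mult_diff_distrib)
  finally show ?thesis
    by (simp add: matrix_vector_mult_diff_distrib)
qed

text \<open>If one entry \<open>s\<close> lies below the common bound by the fraction
  \<open>a\<close>, its weight, at least \<open>w\<close>, passes the share \<open>a * w\<close> of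
  that gain on to the average.\<close>

lemma row_stochastic_average_le:
  assumes W: "row_stochastic W" and z: "\<And>j. \<bar>z j\<bar> \<le> e"
    and s: "\<bar>z s\<bar> \<le> (1 - a) * e" "0 \<le> a" and w: "w \<le> W $ i $ s"
  shows "\<bar>\<Sum>j\<in>UNIV. W $ i $ j * z j\<bar> \<le> (1 - a * w) * e"
proof -
  have nn: "0 \<le> W $ i $ j" and sum1: "(\<Sum>j\<in>UNIV. W $ i $ j) = 1" for j
    using W by (auto simp: row_stochastic_def)
  have e: "0 \<le> e"
    using z[of s] by linarith
  have "\<bar>\<Sum>j\<in>UNIV. W $ i $ j * z j\<bar> \<le> (\<Sum>j\<in>UNIV. W $ i $ j * \<bar>z j\<bar>)"
    using sum_abs[of "\<lambda>j. W $ i $ j * z j" UNIV] nn by (simp add: abs_mult)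
  also have "\<dots> \<le> (\<Sum>j\<in>UNIV. W $ i $ j * e - (if j = s then W $ i $ j * (a * e) else 0))"
  proof (intro sum_mono)
    fix j
    show "W $ i $ j * \<bar>z j\<bar> \<le> W $ i $ j * e - (if j = s then W $ i $ j * (a * e) else 0)"
      using mult_left_mono[OF z[of j] nn[of j]] mult_left_mono[OF s(1) nn[of s]]
      by (auto simp: algebra_simps)
  qed
  also have "\<dots> = e - W $ i $ s * (a * e)"
    by (simp add: sum_subtractf sum1 flip: sum_distrib_right)
  also have "\<dots> \<le> (1 - a * w) * e"
    using mult_right_mono[OF w, of "a * e"] s(2) e by (simp add: algebra_simps)
  finally show ?thesis .
qed

lemma abs_block_diag_M_hat_mult_le:
  assumes M: "mat_infnorm M \<le> 1" and V: "\<And>p. \<bar>V $ p\<bar> \<le> e"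
  shows "\<bar>(block_diag (M_hat M) *v V) $ (j, l)\<bar> \<le> e"
    and "\<bar>(block_diag (M_hat M) *v V) $ (l, l)\<bar> \<le> mat_infnorm M * e"
proof -
  show diag: "\<bar>(block_diag (M_hat M) *v V) $ (l, l)\<bar> \<le> mat_infnorm M * e" for l
    using V by (auto simp: block_diag_M_hat_mult_nth intro: abs_mult_vec_le_mat_infnorm)
  have "0 \<le> e"
    using V abs_ge_zero order_trans by blast
  then have "mat_infnorm M * e \<le> e"
    using mult_right_mono[OF M] by simp
  then show "\<bar>(block_diag (M_hat M) *v V) $ (j, l)\<bar> \<le> e"
    using diag[of l] V[of "(j, l)"]
    by (cases "j = l") (auto simp: block_diag_M_hat_mult_nth simp del: mult_le_cancel_right2)
qed

text \<open>The homogeneous recursion of the errors \<open>F\<close>. The bound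
  \<open>w \<le> 1\<close> keeps the powers \<open>w ^ m\<close> at most 1.\<close>

locale dfix_errors =
  fixes E :: "nat \<Rightarrow> ('n::finite) rel" and W :: "nat \<Rightarrow> real^'n^'n"
    and M :: "real^'n^'n" and F :: "nat \<Rightarrow> real^('n \<times> 'n)" and w :: real
  assumes stochastic: "row_stochastic (W k)"
    and weight: "(j, i) \<in> E k \<Longrightarrow> w \<le> W k $ i $ j"
    and w: "0 \<le> w" "w \<le> 1"
    and M: "mat_infnorm M \<le> 1"
    and F_Suc: "F (Suc k) = kronecker (W k) (mat 1 :: real^'n^'n) *v (block_diag (M_hat M) *v F k)"
begin

abbreviation Z :: "nat \<Rightarrow> real^('n \<times> 'n)" where
  "Z k \<equiv> block_diag (M_hat M) *v F k"

abbreviation rate :: "nat \<Rightarrow> real" where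
  "rate m \<equiv> 1 - (1 - mat_infnorm M) * w ^ m"

lemma F_Suc_nth: "F (Suc k) $ (i, l) = (\<Sum>j\<in>UNIV. W k $ i $ j * Z k $ (j, l))"
  by (simp add: F_Suc kronecker_mat_1_mult_nth)

lemma abs_F_le: "\<bar>F (k + m) $ p\<bar> \<le> infnorm (F k)"
proof (induction m arbitrary: p)
  case 0
  then show ?case by (simp add: component_le_infnorm_cart)
next
  case (Suc m)
  obtain i l where p: "p = (i, l)" by fastforce
  have "\<bar>Z (k + m) $ (j, l)\<bar> \<le> infnorm (F k)" for j
    by (rule abs_block_diag_M_hat_mult_le(1)[OF M Suc.IH])
  \<comment> \<open>No gain is claimed here: the averaging bound is used with \<open>a = 0\<close>
    and \<open>w = 0\<close>, which only says that the step is nonexpansive.\<close>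
  then have "\<bar>F (Suc (k + m)) $ (i, l)\<bar> \<le> (1 - 0 * 0) * infnorm (F k)"
    unfolding F_Suc_nth
    by (intro row_stochastic_average_le[where s = i] stochastic)
      (use stochastic in \<open>auto simp: row_stochastic_def\<close>)
  then show ?case by (simp add: p)
qed

lemmas abs_Z_le = abs_block_diag_M_hat_mult_le[OF M abs_F_le]

text \<open>The gain at \<open>s\<close> is the fraction
  \<open>a = (1 - mat_infnorm M) * w ^ m\<close>; crossing one more edge multiplies it by
  \<open>w\<close>.\<close>

lemma abs_F_Suc_le:
  assumes "(s, i) \<in> E (k + m)" and "\<bar>Z (k + m) $ (s, l)\<bar> \<le> rate m * infnorm (F k)"
  shows "\<bar>F (Suc (k + m)) $ (i, l)\<bar> \<le> rate (Suc m) * infnorm (F k)"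
proof -
  have "\<bar>F (Suc (k + m)) $ (i, l)\<bar> \<le> (1 - ((1 - mat_infnorm M) * w ^ m) * w) * infnorm (F k)"
    unfolding F_Suc_nth
    by (intro row_stochastic_average_le[where s = s] stochastic abs_Z_le assms weight)
      (use M w in auto)
  then show ?thesis by (simp add: mult_ac)
qed

text \<open>
  The invariant is stated after the local update, since only then does it hold for the empty walk.
\<close>

lemma abs_Z_le_rate:
  assumes "(l, i) \<in> graph_comp_seq E k m"
  shows "\<bar>Z (k + m) $ (i, l)\<bar> \<le> rate m * infnorm (F k)"
  using assms
proof (induction m arbitrary: i)
  case 0
  then show ?case using abs_Z_le(2)[of k 0 l] by simp
next
  case (Suc m)
  then obtain s where s: "(l, s) \<in> graph_comp_seq E k m" "(s, i) \<in> E (k + m)"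
    by (auto simp: graph_comp_def)
  \<comment> \<open>If \<open>i = l\<close>, the latest local update alone yields the factor
    \<open>mat_infnorm M\<close>, which is below every rate. Otherwise that update leaves the
    component unchanged, and the bound after consensus along the last edge carries over.\<close>
  show ?case
  proof (cases "i = l")
    case True
    have "(1 - mat_infnorm M) * w ^ Suc m \<le> 1 - mat_infnorm M"
      using M power_le_one[OF w, of "Suc m"] by (simp add: mult_left_le)
    then have "mat_infnorm M * infnorm (F k) \<le> rate (Suc m) * infnorm (F k)"
      by (intro mult_right_mono) (auto simp: infnorm_pos_le)
    with abs_Z_le(2)[of k "Suc m" l] show ?thesis
      unfolding True by (rule order_trans)
  next
    case False
    with abs_F_Suc_le[OF s(2) Suc.IH[OF s(1)]] show ?thesis
      by (simp add: block_diag_M_hat_mult_nth)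
  qed
qed

text \<open>\<open>F\<close> is measured after consensus, so the last edge of the walk is split off:
  the invariant covers the first \<open>m\<close> edges and the final averaging the remaining
  one.\<close>

lemma infnorm_F_le_rate:
  assumes "fully_connected (graph_comp_seq E k (Suc m))"
  shows "infnorm (F (k + Suc m)) \<le> rate (Suc m) * infnorm (F k)"
proof (rule infnorm_le_cart)
  fix p :: "'n \<times> 'n"
  obtain i l where p: "p = (i, l)" by fastforce
  obtain s where "(l, s) \<in> graph_comp_seq E k m" "(s, i) \<in> E (k + m)"
    using assms by (auto simp: fully_connected_def graph_comp_def)
  then show "\<bar>F (k + Suc m) $ p\<bar> \<le> rate (Suc m) * infnorm (F k)"
    using abs_F_Suc_le abs_Z_le_rate p by (metis add_Suc_right)
qed

end

theorem theorem2:
  fixes E :: "nat \<Rightarrow> ('n::finite) rel"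
    and W :: "nat \<Rightarrow> real^'n^'n"
    and M A :: "real^'n^'n"
    and d b ystar :: "real^'n"
    and X :: "nat \<Rightarrow> real^('n \<times> 'n)"
    and Xstar :: "real^('n \<times> 'n)"
    and mbar :: nat
  assumes "\<And>k. has_self_loops (E k)"
    and "0 < mbar"
    and "jointly_fully_connected mbar E"
    and "\<And>k. consensus_matrix (E k) (W k)"
    and "weights_bounded_below E W"
    and "mat_infnorm M < 1"
    and "ystar = M *v ystar + d"
    and "invertible A"
    and "A *v ystar = b"
    and "\<And>k. X (Suc k) = dfix_step (W k) M d (X k)"
    and "Xstar = stack (\<lambda>_. ystar)"
  shows "\<exists>\<sigma><1. \<forall>k. mbar - 1 \<le> k \<longrightarrow>
           infnorm (X (k + 1) - Xstar) \<le> \<sigma> * infnorm (X (k + 1 - mbar) - Xstar)"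
proof -
  obtain w0 where w0: "w0 > 0" "\<And>k i j. (j, i) \<in> E k \<Longrightarrow> w0 \<le> W k $ i $ j"
    using assms(5) by (auto simp: weights_bounded_below_def)
  \<comment> \<open>Capping at 1 gives the bound required by the locale and keeps \<open>w\<close>
    positive, so that \<open>rate mbar < 1\<close>.\<close>
  define w where "w = min w0 1"
  define F where "F = (\<lambda>k. X k - Xstar)"
  have stoch: "row_stochastic (W k)" for k
    using assms(4) by (simp add: consensus_matrix_def)
  interpret dfix_errors E W M F w
  proof
    show "F (Suc k) = kronecker (W k) (mat 1 :: real^'n^'n) *v (block_diag (M_hat M) *v F k)" for k
      by (simp only: F_def assms(10,11) dfix_step_error[OF stoch assms(7)])
    show "w \<le> W k $ i $ j" if "(j, i) \<in> E k" for i j k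
      using w0(2)[OF that] by (simp add: w_def)
  qed (use w0 assms(6) stoch in \<open>auto simp: w_def\<close>)
  show ?thesis
  proof (intro exI conjI allI impI)
    show "rate mbar < 1"
      using assms(6) w0(1) by (simp add: w_def)
    fix k assume "mbar - 1 \<le> k"
    obtain m where m: "mbar = Suc m"
      using assms(2) gr0_conv_Suc by blast
    \<comment> \<open>The truncated subtraction is exact because \<open>mbar - 1 \<le> k\<close>, so
      this index is \<open>k + 1\<close>.\<close>
    have "infnorm (F (k + 1 - mbar + mbar)) \<le> rate mbar * infnorm (F (k + 1 - mbar))"
      using infnorm_F_le_rate assms(3) unfolding m jointly_fully_connected_def by blast
    then show "infnorm (X (k + 1) - Xstar) \<le> rate mbar * infnorm (X (k + 1 - mbar) - Xstar)"
      using \<open>mbar - 1 \<le> k\<close> by (simp add: F_def)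
  qed
qed

end
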